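(* Let $V$ be an $N=2$ vertex superalgebra with two odd formal variables. Let $\mathcal{D}^\pm$ be the odd endomorphisms of $V$ defined by $\mathcal{D}^\pm(v)=v^\pm_{-\frac32}\mathbf{1}$, and let $\mathcal{D}$ be the even endomorphism of $V$ defined by $\mathcal{D}=\frac12[\mathcal{D}^+,\mathcal{D}^-]$. Then for all $v\in V$ $$Y(\mathcal{D}v,(x,\varphi^+,\varphi^-))=\frac{\partial}{\partial x}Y(v,(x,\varphi^+,\varphi^-)).$$ Furthermore, $\mathcal{D}(v)=v_{-2}\mathbf{1}$ for all $v\in V$.
   Context: Grassmann algebra: $\bigwedge_L$ ($L\in\mathbb{N}$) is the exterior algebra over $\mathbb{C}$ on $L$ generators, $\bigwedge_L\subset\bigwedge_{L+1}$, $\bigwedge_\infty=\bigcup_L\bigwedge_L$; $\bigwedge_*$ is one of these, with even and odd parts $\bigwedge_*^0,\bigwedge_*^1$. For $V=V^0\oplus V^1$ write $\eta(v)=j$ if $v\in V^j$. $[A,B]=AB-(-1)^{\eta(A)\eta(B)}BA$ is the supercommutator, so $[\mathcal{D}^+,\mathcal{D}^-]=\mathcal{D}^+\mathcal{D}^-+\mathcal{D}^-\mathcal{D}^+$. Formal variables: $x,x_0,x_1,x_2$ are even (commute with everything); $\varphi^\pm,\varphi_1^\pm,\varphi_2^\pm$ are odd (commute with even variables and even elements; anticommute with each other, with $\bigwedge_*^1$ and with odd endomorphisms; squares vanish). $\delta(x)=\sum_{n\in\mathbb{Z}}x^n$; expressions containing products of odd variables are Taylor expanded about the even variables, and powers of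 a sum of two even variables are expanded in nonnegative powers of the second one, e.g. $\delta\big(\frac{x_1-x_2-\nu}{x_0}\big)=\sum_n(x_1-x_2-\nu)^nx_0^{-n}$. An $N=2$ vertex superalgebra over $\bigwedge_*$ with two odd formal variables, $(V,Y(\cdot,(x,\varphi^+,\varphi^-)),\mathbf{1})$, consists of a $\mathbb{Z}_2$-graded $\bigwedge_*$-module $V=V^0\oplus V^1$, a linear map $v\mapsto Y(v,(x,\varphi^+,\varphi^-))=\sum_{n\in\mathbb{Z}}(v_n+\varphi^+v^+_{n-\frac12}+\varphi^-v^-_{n-\frac12}+\varphi^+\varphi^-v^{+-}_{n-1})x^{-n-1}\in(\mathrm{End}\,V)[[x,x^{-1}]][\varphi^+,\varphi^-]$ with $v_n,v^{+-}_n\in(\mathrm{End}\,V)^{\eta(v)}$ and $v^\pm_{n-\frac12}\in(\mathrm{End}\,V)^{\eta(v)+1\bmod2}$ for homogeneous $v$, and $\mathbf{1}\in V$, such that for $u,v\in V$: (truncation) $u_nv=u^{+-}_nv=u^\pm_{n-\frac12}v=0$ for $n$ sufficiently large; (vacuum) $Y(\mathbf{1},(x,\varphi^+,\varphi^-))=\mathrm{id}_V$; (creation) $Y(v,(x,\varphi^+,\varphi^-))\mathbf{1}\in V[[x]][\varphi^+,\varphi^-]$ and its value at $(x,\varphi^+,\varphi^-)=0$ is $v$; (Jacobi identity) for $u,v$ of homogeneous sign $$x_0^{-1}\delta\Big(\tfrac{x_1-x_2-\varphi_1^+\varphi_2^--\varphi_1^-\varphi_2^+}{x_0}\Big)Y(u,(x_1,\varphi_1^+,\varphi_1^-))Y(v,(x_2,\varphi_2^+,\varphi_2^-))-(-1)^{\eta(u)\eta(v)}x_0^{-1}\delta\Big(\tfrac{x_2-x_1+\varphi_1^+\varphi_2^-+\varphi_1^-\varphi_2^+}{-x_0}\Big)Y(v,(x_2,\varphi_2^+,\varphi_2^-))Y(u,(x_1,\varphi_1^+,\varphi_1^-))$$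 $$=x_2^{-1}\delta\Big(\tfrac{x_1-x_0-\varphi_1^+\varphi_2^--\varphi_1^-\varphi_2^+}{x_2}\Big)Y(Y(u,(x_0,\varphi_1^+-\varphi_2^+,\varphi_1^--\varphi_2^-))v,(x_2,\varphi_2^+,\varphi_2^-)).$$ *)

theory Defs
  imports
    Complex_Main
    "HOL-Library.Extended_Nat"
    "HOL-Library.Groups_Big_Fun"
    "HOL-Library.Product_Plus"
    "HOL-Library.Z2"
begin

section \<open>Exterior algebras\<close>

text \<open>
  An element of the exterior algebra over the complex numbers on the generators \<open>'g\<close> is given by
  its coordinates \<open>c S\<close> in the basis of monomials \<open>g\<^sub>1 g\<^sub>2 \<dots> g\<^sub>r\<close> with
  \<open>S = {g\<^sub>1 < g\<^sub>2 < \<dots> < g\<^sub>r}\<close>. The type is used twice: with \<open>'g = nat\<close> for the ring of scalars,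
  and with the four odd formal variables of the Jacobi identity as generators.
\<close>

typedef (overloaded) 'g::linorder grassmann =
    "{c :: 'g set \<Rightarrow> complex. finite {S. c S \<noteq> 0} \<and> (\<forall>S. c S \<noteq> 0 \<longrightarrow> finite S)}"
  morphisms gcoeff Abs_grassmann
  by (rule exI[of _ "\<lambda>_. 0"]) simp

setup_lifting type_definition_grassmann

lemma grassmann_eqI: "(\<And>S. gcoeff a S = gcoeff b S) \<Longrightarrow> a = b"
  by transfer auto

lemma finite_gcoeff: "finite {S. gcoeff a S \<noteq> 0}"
  by transfer auto

text \<open>The product of the monomials of \<open>A\<close> and \<open>B\<close> (disjoint) is \<open>gsign A B\<close> times that of
  \<open>A \<union> B\<close>: one sign for every pair that has to be interchanged.\<close>

definition gsign :: "'g::linorder set \<Rightarrow> 'g set \<Rightarrow> complex" where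
  "gsign A B = (- 1) ^ card {(a, b) \<in> A \<times> B. b < a}"

lemma gsign_empty [simp]: "gsign {} B = 1" "gsign A {} = 1"
  by (auto simp: gsign_def)

lemma gsign_Un1:
  assumes "finite A" "finite B" "finite C" "A \<inter> B = {}"
  shows "gsign (A \<union> B) C = gsign A C * gsign B C"
proof -
  have "{(a, b) \<in> (A \<union> B) \<times> C. b < a} = {(a, b) \<in> A \<times> C. b < a} \<union> {(a, b) \<in> B \<times> C. b < a}"
    by auto
  moreover have "finite {(a, b) \<in> A \<times> C. b < a}" "finite {(a, b) \<in> B \<times> C. b < a}"
    using assms by (auto intro: finite_subset[of _ "A \<times> C"] finite_subset[of _ "B \<times> C"])
  moreover have "{(a, b) \<in> A \<times> C. b < a} \<inter> {(a, b) \<in> B \<times> C. b < a} = {}"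
    using assms by auto
  ultimately show ?thesis
    by (simp add: gsign_def card_Un_disjoint power_add)
qed

lemma gsign_Un2:
  assumes "finite A" "finite B" "finite C" "B \<inter> C = {}"
  shows "gsign A (B \<union> C) = gsign A B * gsign A C"
proof -
  have "{(a, b) \<in> A \<times> (B \<union> C). b < a} = {(a, b) \<in> A \<times> B. b < a} \<union> {(a, b) \<in> A \<times> C. b < a}"
    by auto
  moreover have "finite {(a, b) \<in> A \<times> B. b < a}" "finite {(a, b) \<in> A \<times> C. b < a}"
    using assms by (auto intro: finite_subset[of _ "A \<times> C"] finite_subset[of _ "A \<times> B"])
  moreover have "{(a, b) \<in> A \<times> B. b < a} \<inter> {(a, b) \<in> A \<times> C. b < a} = {}"
    using assms by auto
  ultimately show ?thesis
    by (simp add: gsign_def card_Un_disjoint power_add)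
qed

instantiation grassmann :: (linorder) ab_group_add
begin

lift_definition zero_grassmann :: "'a grassmann" is "\<lambda>_. 0" by simp

lift_definition plus_grassmann :: "'a grassmann \<Rightarrow> 'a grassmann \<Rightarrow> 'a grassmann"
  is "\<lambda>a b S. a S + b S"
proof -
  fix a b :: "'a set \<Rightarrow> complex"
  assume a: "finite {S. a S \<noteq> 0} \<and> (\<forall>S. a S \<noteq> 0 \<longrightarrow> finite S)"
    and b: "finite {S. b S \<noteq> 0} \<and> (\<forall>S. b S \<noteq> 0 \<longrightarrow> finite S)"
  have "{S. a S + b S \<noteq> 0} \<subseteq> {S. a S \<noteq> 0} \<union> {S. b S \<noteq> 0}" by auto
  with a b show "finite {S. a S + b S \<noteq> 0} \<and> (\<forall>S. a S + b S \<noteq> 0 \<longrightarrow> finite S)"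
    by (metis (mono_tags, lifting) add.right_neutral finite_UnI finite_subset)
qed

lift_definition uminus_grassmann :: "'a grassmann \<Rightarrow> 'a grassmann" is "\<lambda>a S. - a S" by simp

definition minus_grassmann :: "'a grassmann \<Rightarrow> 'a grassmann \<Rightarrow> 'a grassmann" where
  "minus_grassmann a b = a + - b"

instance
  by standard (rule grassmann_eqI, simp add: minus_grassmann_def zero_grassmann.rep_eq
      plus_grassmann.rep_eq uminus_grassmann.rep_eq algebra_simps)+

end

instantiation grassmann :: (linorder) ring_1
begin

lift_definition one_grassmann :: "'a grassmann" is "\<lambda>S. if S = {} then 1 else 0" by simp

lift_definition times_grassmann :: "'a grassmann \<Rightarrow> 'a grassmann \<Rightarrow> 'a grassmann"
  is "\<lambda>a b S. \<Sum>A\<in>Pow S. gsign A (S - A) * a A * b (S - A)"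
proof -
  fix a b :: "'a set \<Rightarrow> complex"
  assume a: "finite {S. a S \<noteq> 0} \<and> (\<forall>S. a S \<noteq> 0 \<longrightarrow> finite S)"
    and b: "finite {S. b S \<noteq> 0} \<and> (\<forall>S. b S \<noteq> 0 \<longrightarrow> finite S)"
  let ?p = "\<lambda>S. \<Sum>A\<in>Pow S. gsign A (S - A) * a A * b (S - A)"
  have "{S. ?p S \<noteq> 0} \<subseteq> (\<lambda>(A, B). A \<union> B) ` ({S. a S \<noteq> 0} \<times> {S. b S \<noteq> 0})"
  proof
    fix S assume "S \<in> {S. ?p S \<noteq> 0}"
    then obtain A where A: "A \<in> Pow S" "gsign A (S - A) * a A * b (S - A) \<noteq> 0"
      by (metis (mono_tags, lifting) mem_Collect_eq sum.neutral)
    then have "S = A \<union> (S - A)" "a A \<noteq> 0" "b (S - A) \<noteq> 0" by auto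
    then show "S \<in> (\<lambda>(A, B). A \<union> B) ` ({S. a S \<noteq> 0} \<times> {S. b S \<noteq> 0})"
      by (metis (mono_tags, lifting) SigmaI case_prod_conv image_eqI mem_Collect_eq)
  qed
  then have "finite {S. ?p S \<noteq> 0}"
    using a b by (meson finite_SigmaI finite_imageI finite_subset)
  moreover have "?p S = 0" if "infinite S" for S
    using that by (simp add: sum.infinite)
  ultimately show "finite {S. ?p S \<noteq> 0} \<and> (\<forall>S. ?p S \<noteq> 0 \<longrightarrow> finite S)"
    by blast
qed

lemma gcoeff_times:
  "gcoeff (a * b) S = (\<Sum>A\<in>Pow S. gsign A (S - A) * gcoeff a A * gcoeff b (S - A))"
  by transfer simp

lemma gcoeff_infinite: "infinite S \<Longrightarrow> gcoeff a S = 0"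
  by transfer auto

instance
proof
  fix a b c :: "'a grassmann"
  show "a * b * c = a * (b * c)"
  proof (rule grassmann_eqI)
    fix S :: "'a set"
    show "gcoeff (a * b * c) S = gcoeff (a * (b * c)) S"
    proof (cases "finite S")
      case False
      then show ?thesis by (simp add: gcoeff_infinite)
    next
      case True
      have "gcoeff (a * b * c) S = (\<Sum>(A, B)\<in>(SIGMA A:Pow S. Pow A).
          gsign A (S - A) * (gsign B (A - B) * gcoeff a B * gcoeff b (A - B)) * gcoeff c (S - A))"
        using True by (subst sum.Sigma[symmetric])
          (auto simp: gcoeff_times sum_distrib_left sum_distrib_right intro: finite_subset)
      also have "\<dots> = (\<Sum>(B, C)\<in>(SIGMA B:Pow S. Pow (S - B)).
          gsign B (S - B) * gcoeff a B * (gsign C (S - B - C) * gcoeff b C * gcoeff c (S - B - C)))"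
      proof (rule sum.reindex_bij_witness[of _ "\<lambda>(B, C). (B \<union> C, B)" "\<lambda>(A, B). (B, A - B)"],
             goal_cases)
        case (5 x)
        then obtain A B where x: "x = (A, B)" "A \<subseteq> S" "B \<subseteq> A" by auto
        define C where "C = A - B"
        define D where "D = S - A"
        have f: "finite B" "finite C" "finite D"
          using True x by (auto simp: C_def D_def intro: finite_subset)
        have e: "A = B \<union> C" "S - B = C \<union> D" "S - B - C = D" "B \<inter> C = {}" "C \<inter> D = {}"
          "A - B = C" "S - A = D"
          using x by (auto simp: C_def D_def)
        have "gsign A (S - A) * gsign B (A - B) = gsign B (S - B) * gsign C (S - B - C)"
          using f e by (simp add: gsign_Un1 gsign_Un2 mult_ac)
        then show ?case
          unfolding x prod.case e(3) e(6) e(7) by (simp add: mult_ac)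
      qed auto
      also have "\<dots> = gcoeff (a * (b * c)) S"
        using True by (subst sum.Sigma[symmetric])
          (auto simp: gcoeff_times sum_distrib_left sum_distrib_right mult_ac intro: finite_subset)
      finally show ?thesis .
    qed
  qed
  show "1 * a = a"
  proof (rule grassmann_eqI)
    fix S :: "'a set"
    show "gcoeff (1 * a) S = gcoeff a S"
    proof (cases "finite S")
      case False
      then show ?thesis by (simp add: gcoeff_infinite)
    next
      case True
      have "gcoeff (1 * a) S = (\<Sum>A\<in>Pow S. if A = {} then gcoeff a S else 0)"
        unfolding gcoeff_times by (rule sum.cong) (auto simp: one_grassmann.rep_eq)
      also have "\<dots> = gcoeff a S" using True by simp
      finally show ?thesis .
    qed
  qed
  show "a * 1 = a"
  proof (rule grassmann_eqI)
    fix S :: "'a set"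
    show "gcoeff (a * 1) S = gcoeff a S"
    proof (cases "finite S")
      case False
      then show ?thesis by (simp add: gcoeff_infinite)
    next
      case True
      have "gcoeff (a * 1) S = (\<Sum>A\<in>Pow S. if A = S then gcoeff a S else 0)"
        unfolding gcoeff_times by (rule sum.cong) (auto simp: one_grassmann.rep_eq)
      also have "\<dots> = gcoeff a S" using True by simp
      finally show ?thesis .
    qed
  qed
  show "(a + b) * c = a * c + b * c" "a * (b + c) = a * b + a * c"
    by (rule grassmann_eqI,
        simp add: gcoeff_times plus_grassmann.rep_eq algebra_simps sum.distrib)+
  show "(0 :: 'a grassmann) \<noteq> 1"
    by transfer (metis zero_neq_one)
qed

end

lift_definition gconst :: "complex \<Rightarrow> 'g::linorder grassmann"
  is "\<lambda>c S. if S = {} then c else 0" by simp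

lift_definition gen :: "'g::linorder \<Rightarrow> 'g grassmann"
  is "\<lambda>g S. if S = {g} then 1 else 0" by simp

lemma gcoeff_gen_times:
  "gcoeff (gen g * gen h) S =
     (if g \<noteq> h \<and> S = {g, h} then if h < g then - 1 else 1 else 0)"
proof (cases "g \<noteq> h \<and> S = {g, h}")
  case True
  have "gcoeff (gen g * gen h) S = (\<Sum>A\<in>Pow S. if A = {g} then gsign {g} {h} else 0)"
    unfolding gcoeff_times using True by (intro sum.cong) (auto simp: gen.rep_eq)
  also have "\<dots> = gsign {g} {h}" using True by simp
  also have "{(a, b) \<in> {g} \<times> {h}. b < a} = (if h < g then {(g, h)} else {})" by auto
  then have "gsign {g} {h} = (if h < g then - 1 else 1)" by (simp add: gsign_def)
  finally show ?thesis using True by simp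
next
  case False
  have "gcoeff (gen g * gen h) S = (\<Sum>A\<in>Pow S. 0)"
    unfolding gcoeff_times using False by (intro sum.cong) (auto simp: gen.rep_eq)
  then show ?thesis using False by auto
qed

lemma gen_square: "gen g * gen g = 0"
  by (rule grassmann_eqI) (simp add: gcoeff_gen_times zero_grassmann.rep_eq)

lemma gen_anticommute: "gen g * gen h = - (gen h * gen g)"
  by (rule grassmann_eqI) (auto simp: gcoeff_gen_times uminus_grassmann.rep_eq insert_commute)

text \<open>The ring of scalars on \<open>L\<close> generators (\<open>L = \<infinity>\<close> allowed), and its part of parity \<open>j\<close>. Parities
  are elements of the two-element field \<open>bit\<close>.\<close>

definition Lam :: "enat \<Rightarrow> nat grassmann set" where
  "Lam L = {a. \<forall>S. gcoeff a S \<noteq> 0 \<longrightarrow> (\<forall>i\<in>S. enat i < L)}"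

definition Lam_part :: "enat \<Rightarrow> bit \<Rightarrow> nat grassmann set" where
  "Lam_part L j = {a \<in> Lam L. \<forall>S. gcoeff a S \<noteq> 0 \<longrightarrow> of_nat (card S) = j}"


section \<open>Graded modules and their endomorphisms\<close>

text \<open>\<open>psign p x\<close> is \<open>(-1)\<^sup>p x\<close>.\<close>

definition psign :: "bit \<Rightarrow> 'a::ab_group_add \<Rightarrow> 'a" where
  "psign p x = (if p = 0 then x else - x)"

text \<open>The module is the whole type \<open>'v\<close>; \<open>V j\<close> is its part of parity \<open>j\<close>.\<close>

locale graded_module =
  fixes L :: enat
    and smul :: "nat grassmann \<Rightarrow> 'v::ab_group_add \<Rightarrow> 'v"
    and V :: "bit \<Rightarrow> 'v set"
  assumes smul_add_right: "a \<in> Lam L \<Longrightarrow> smul a (v + w) = smul a v + smul a w"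
    and smul_add_left: "a \<in> Lam L \<Longrightarrow> b \<in> Lam L \<Longrightarrow> smul (a + b) v = smul a v + smul b v"
    and smul_smul: "a \<in> Lam L \<Longrightarrow> b \<in> Lam L \<Longrightarrow> smul (a * b) v = smul a (smul b v)"
    and smul_one: "smul 1 v = v"
    and part_zero: "0 \<in> V j"
    and part_add: "v \<in> V j \<Longrightarrow> w \<in> V j \<Longrightarrow> v + w \<in> V j"
    and part_smul: "a \<in> Lam_part L i \<Longrightarrow> v \<in> V j \<Longrightarrow> smul a v \<in> V (i + j)"
    and part_direct: "V 0 \<inter> V 1 = {0}"
    and part_span: "\<exists>v0\<in>V 0. \<exists>v1\<in>V 1. v = v0 + v1"

text \<open>Endomorphisms of parity \<open>j\<close>; an odd endomorphism anticommutes with odd scalars.\<close>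

definition End_part ::
  "enat \<Rightarrow> (nat grassmann \<Rightarrow> 'v::ab_group_add \<Rightarrow> 'v) \<Rightarrow> (bit \<Rightarrow> 'v set) \<Rightarrow> bit \<Rightarrow> ('v \<Rightarrow> 'v) set"
where
  "End_part L smul V j = {T.
     (\<forall>v w. T (v + w) = T v + T w) \<and>
     (\<forall>i. \<forall>a\<in>Lam_part L i. \<forall>v. T (smul a v) = psign (i * j) (smul a (T v))) \<and>
     (\<forall>i. \<forall>v\<in>V i. T v \<in> V (j + i))}"

text \<open>The supercommutator of endomorphisms \<open>A\<close> of parity \<open>i\<close> and \<open>B\<close> of parity \<open>j\<close>.\<close>

definition supercomm :: "bit \<Rightarrow> bit \<Rightarrow> ('v::ab_group_add \<Rightarrow> 'v) \<Rightarrow> ('v \<Rightarrow> 'v) \<Rightarrow> 'v \<Rightarrow> 'v" where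
  "supercomm i j A B v = A (B v) - psign (i * j) (B (A v))"

text \<open>The involution \<open>v0 + v1 \<mapsto> v0 - v1\<close>. Conjugating an endomorphism \<open>T\<close> with it gives
  \<open>(-1)\<^sup>j T\<close> for \<open>T\<close> of parity \<open>j\<close>, so that moving \<open>T\<close> past a product of \<open>n\<close> odd variables turns it into
  \<open>past V n T\<close>.\<close>

definition par_inv :: "(bit \<Rightarrow> 'v::ab_group_add set) \<Rightarrow> 'v \<Rightarrow> 'v" where
  "par_inv V v = (let v0 = (THE v0. v0 \<in> V 0 \<and> v - v0 \<in> V 1) in v0 - (v - v0))"

definition past :: "(bit \<Rightarrow> 'v::ab_group_add set) \<Rightarrow> nat \<Rightarrow> ('v \<Rightarrow> 'v) \<Rightarrow> 'v \<Rightarrow> 'v" where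
  "past V n T = (par_inv V ^^ n) \<circ> T \<circ> (par_inv V ^^ n)"


section \<open>Formal series in one even and two odd variables\<close>

datatype phi = PhiP | PhiM

instance phi :: finite
proof
  have "(UNIV :: phi set) = {PhiP, PhiM}" by (auto intro: phi.exhaust)
  then show "finite (UNIV :: phi set)" by (metis finite.emptyI finite.insertI)
qed

text \<open>\<open>f S k\<close> is the coefficient of \<open>\<phi>\<^sup>S x\<^sup>k\<close>, where \<open>\<phi>\<^sup>S\<close> is \<open>1\<close>, \<open>\<phi>\<^sup>+\<close>, \<open>\<phi>\<^sup>-\<close> or
  \<open>\<phi>\<^sup>+\<phi>\<^sup>-\<close> and stands to the left of the coefficient.\<close>

type_synonym 'a series = "phi set \<Rightarrow> int \<Rightarrow> 'a"

definition ddx :: "(nat grassmann \<Rightarrow> 'v::ab_group_add \<Rightarrow> 'v) \<Rightarrow> ('v \<Rightarrow> 'v) series \<Rightarrow> ('v \<Rightarrow> 'v) series"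
where
  "ddx smul f S k w = smul (of_int (k + 1)) (f S (k + 1) w)"

text \<open>In the usual notation the following are \<open>v\<^sub>n\<close>, \<open>v\<^sup>+\<close> and \<open>v\<^sup>-\<close> with index \<open>n - 1/2\<close>, and
  \<open>v\<^sup>+\<^sup>-\<close> with index \<open>n - 1\<close>: the coefficients belonging to \<open>x\<close> to the power \<open>- n - 1\<close>.\<close>

definition mode :: "('v \<Rightarrow> ('v \<Rightarrow> 'v) series) \<Rightarrow> 'v \<Rightarrow> int \<Rightarrow> 'v \<Rightarrow> 'v" where
  "mode Y v n = Y v {} (- n - 1)"

definition mode_plus :: "('v \<Rightarrow> ('v \<Rightarrow> 'v) series) \<Rightarrow> 'v \<Rightarrow> int \<Rightarrow> 'v \<Rightarrow> 'v" where
  "mode_plus Y v n = Y v {PhiP} (- n - 1)"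

definition mode_minus :: "('v \<Rightarrow> ('v \<Rightarrow> 'v) series) \<Rightarrow> 'v \<Rightarrow> int \<Rightarrow> 'v \<Rightarrow> 'v" where
  "mode_minus Y v n = Y v {PhiM} (- n - 1)"

definition mode_plus_minus :: "('v \<Rightarrow> ('v \<Rightarrow> 'v) series) \<Rightarrow> 'v \<Rightarrow> int \<Rightarrow> 'v \<Rightarrow> 'v" where
  "mode_plus_minus Y v n = Y v {PhiP, PhiM} (- n - 1)"


section \<open>Formal series in the variables of the Jacobi identity\<close>

datatype ovar = Phi1P | Phi1M | Phi2P | Phi2M

instantiation ovar :: linorder
begin

definition ovar_rank :: "ovar \<Rightarrow> nat" where
  "ovar_rank a = (case a of Phi1P \<Rightarrow> 0 | Phi1M \<Rightarrow> 1 | Phi2P \<Rightarrow> 2 | Phi2M \<Rightarrow> 3)"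

definition less_eq_ovar :: "ovar \<Rightarrow> ovar \<Rightarrow> bool" where
  "a \<le> b \<longleftrightarrow> ovar_rank a \<le> ovar_rank b"

definition less_ovar :: "ovar \<Rightarrow> ovar \<Rightarrow> bool" where
  "a < b \<longleftrightarrow> ovar_rank a < ovar_rank b"

instance
  by standard (auto simp: less_eq_ovar_def less_ovar_def ovar_rank_def split: ovar.splits)

end

instance ovar :: finite
proof
  have "(UNIV :: ovar set) = {Phi1P, Phi1M, Phi2P, Phi2M}" by (auto intro: ovar.exhaust)
  then show "finite (UNIV :: ovar set)" by (metis finite.emptyI finite.insertI)
qed

text \<open>\<open>F (k0, k1, k2) T\<close> is the coefficient of \<open>\<phi>\<^sup>T x\<^sub>0\<^sup>k\<^sup>0 x\<^sub>1\<^sup>k\<^sup>1 x\<^sub>2\<^sup>k\<^sup>2\<close>, again with the odd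
  variables (in increasing order) on the left.\<close>

type_synonym expo = "int \<times> int \<times> int"

type_synonym 'a superseries = "expo \<Rightarrow> ovar set \<Rightarrow> 'a"

text \<open>The exponents of the \<open>k\<close>-th powers of the three even variables. Below, a function of this type
  is used to name an even variable.\<close>

definition X0 :: "int \<Rightarrow> expo" where "X0 k = (k, 0, 0)"

definition X1 :: "int \<Rightarrow> expo" where "X1 k = (0, k, 0)"

definition X2 :: "int \<Rightarrow> expo" where "X2 k = (0, 0, k)"

text \<open>\<open>at_vars smul x \<alpha> \<beta> f\<close> is \<open>f (x, (\<alpha>, \<beta>))\<close> for a series \<open>f\<close> with coefficients in the module and
  linear forms \<open>\<alpha>\<close>, \<open>\<beta>\<close> in the odd variables; \<open>Y_at\<close> is the vertex operator \<open>Y (v, (x, \<alpha>, \<beta>))\<close>.\<close>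

definition at_vars ::
  "(nat grassmann \<Rightarrow> 'v::ab_group_add \<Rightarrow> 'v) \<Rightarrow> (int \<Rightarrow> expo) \<Rightarrow> ovar grassmann \<Rightarrow> ovar grassmann
    \<Rightarrow> 'v series \<Rightarrow> 'v superseries"
where
  "at_vars smul x \<alpha> \<beta> f K T = (\<Sum>(k, S)\<in>{(k, S). x k = K}.
     smul (gconst (gcoeff ((if PhiP \<in> S then \<alpha> else 1) * (if PhiM \<in> S then \<beta> else 1)) T)) (f S k))"

definition Y_at ::
  "(nat grassmann \<Rightarrow> 'v::ab_group_add \<Rightarrow> 'v) \<Rightarrow> ('v \<Rightarrow> ('v \<Rightarrow> 'v) series)
    \<Rightarrow> (int \<Rightarrow> expo) \<Rightarrow> ovar grassmann \<Rightarrow> ovar grassmann \<Rightarrow> 'v \<Rightarrow> ('v \<Rightarrow> 'v) superseries"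
where
  "Y_at smul Y x \<alpha> \<beta> v K T w = at_vars smul x \<alpha> \<beta> (\<lambda>S k. Y v S k w) K T"

text \<open>Products involve infinite sums of coefficients which, applied to a vector, have only finitely
  many nonzero terms (by the truncation condition). Therefore all series are applied to a vector, and
  \<open>Sum_any\<close>, the sum of the nonzero terms, is used.

  \<open>op_apply\<close> is the action of a series \<open>G\<close> of endomorphisms on a series \<open>F\<close> of vectors, with
  \<open>\<phi>\<^sup>A T \<phi>\<^sup>B w = \<phi>\<^sup>A \<phi>\<^sup>B (past V |B| T) w\<close>.\<close>

definition op_apply ::
  "(nat grassmann \<Rightarrow> 'v::ab_group_add \<Rightarrow> 'v) \<Rightarrow> (bit \<Rightarrow> 'v set)
    \<Rightarrow> ('v \<Rightarrow> 'v) superseries \<Rightarrow> 'v superseries \<Rightarrow> 'v superseries"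
where
  "op_apply smul V G F K T = Sum_any (\<lambda>K'. \<Sum>A\<in>Pow T.
     smul (gconst (gsign A (T - A))) (past V (card (T - A)) (G K' A) (F (K - K') (T - A))))"

text \<open>\<open>Y (F, (x, \<alpha>, \<beta>)) w\<close> for a series \<open>F\<close> of vectors; \<open>Y\<close> is linear and even, so that
  \<open>Y (\<phi>\<^sup>A v, (x, \<alpha>, \<beta>)) = \<phi>\<^sup>A Y (v, (x, \<alpha>, \<beta>))\<close>.\<close>

definition Y_series ::
  "(nat grassmann \<Rightarrow> 'v::ab_group_add \<Rightarrow> 'v) \<Rightarrow> ('v \<Rightarrow> ('v \<Rightarrow> 'v) series)
    \<Rightarrow> (int \<Rightarrow> expo) \<Rightarrow> ovar grassmann \<Rightarrow> ovar grassmann \<Rightarrow> 'v superseries \<Rightarrow> 'v \<Rightarrow> 'v superseries"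
where
  "Y_series smul Y x \<alpha> \<beta> F w K T = Sum_any (\<lambda>K'. \<Sum>A\<in>Pow T.
     smul (gconst (gsign A (T - A))) (Y_at smul Y x \<alpha> \<beta> (F K' A) (K - K') (T - A) w))"

text \<open>The product of a scalar series with a series of vectors.\<close>

definition scale_series ::
  "(nat grassmann \<Rightarrow> 'v::ab_group_add \<Rightarrow> 'v) \<Rightarrow> (expo \<Rightarrow> ovar grassmann)
    \<Rightarrow> 'v superseries \<Rightarrow> 'v superseries"
where
  "scale_series smul d F K T = Sum_any (\<lambda>K'. \<Sum>A\<in>Pow T.
     smul (gconst (gsign A (T - A) * gcoeff (d K') A)) (F (K - K') (T - A)))"

text \<open>The coefficient of \<open>y\<^sup>p z\<^sup>q\<close> in \<open>(y - z)\<^sup>m\<close>, and in \<open>(y - z + \<nu>)\<^sup>n\<close> for even nilpotent \<open>\<nu>\<close>. The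
  former is expanded in nonnegative powers of \<open>z\<close>, the latter is the (finite) Taylor expansion
  \<open>\<Sum>\<^sub>k (n choose k) \<nu>\<^sup>k (y - z)\<^sup>n\<^sup>-\<^sup>k\<close>.\<close>

definition pow_diff :: "int \<Rightarrow> int \<Rightarrow> int \<Rightarrow> complex" where
  "pow_diff m p q =
     (if 0 \<le> q \<and> p + q = m then (of_int m gchoose nat q) * (- 1) ^ nat q else 0)"

definition pow_diff_nil :: "int \<Rightarrow> ovar grassmann \<Rightarrow> int \<Rightarrow> int \<Rightarrow> ovar grassmann" where
  "pow_diff_nil n \<nu> p q =
     (\<Sum>k | \<nu> ^ k \<noteq> 0. gconst ((of_int n gchoose k) * pow_diff (n - int k) p q) * \<nu> ^ k)"

text \<open>The series \<open>x\<^sup>-\<^sup>1 \<delta> ((y - z + \<nu>) / (\<epsilon> x)) = \<Sum>\<^sub>n (y - z + \<nu>)\<^sup>n \<epsilon>\<^sup>-\<^sup>n x\<^sup>-\<^sup>n\<^sup>-\<^sup>1\<close> for three different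
  even variables \<open>x\<close>, \<open>y\<close>, \<open>z\<close>.\<close>

definition delta_series ::
  "(int \<Rightarrow> expo) \<Rightarrow> complex \<Rightarrow> (int \<Rightarrow> expo) \<Rightarrow> (int \<Rightarrow> expo) \<Rightarrow> ovar grassmann
    \<Rightarrow> expo \<Rightarrow> ovar grassmann"
where
  "delta_series x \<epsilon> y z \<nu> K = (\<Sum>(n, p, q)\<in>{(n, p, q). x (- n - 1) + y p + z q = K}.
     gconst (\<epsilon> powi (- n)) * pow_diff_nil n \<nu> p q)"

definition nu :: "ovar grassmann" where
  "nu = gen Phi1P * gen Phi2M + gen Phi1M * gen Phi2P"


section \<open>Vertex superalgebras\<close>

locale N2_vertex_superalgebra = graded_module L smul V
  for L :: enat
    and smul :: "nat grassmann \<Rightarrow> 'v::ab_group_add \<Rightarrow> 'v"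
    and V :: "bit \<Rightarrow> 'v set" +
  fixes Y :: "'v \<Rightarrow> ('v \<Rightarrow> 'v) series"
    and vac :: 'v
  assumes Y_add: "Y (u + v) S k w = Y u S k w + Y v S k w"
    \<comment> \<open>the sign comes from moving \<open>a\<close> past \<open>\<phi>\<^sup>S\<close>\<close>
    and Y_smul: "a \<in> Lam_part L i \<Longrightarrow>
      Y (smul a v) S k w = psign (i * of_nat (card S)) (smul a (Y v S k w))"
    and mode_parity: "v \<in> V p \<Longrightarrow> mode Y v n \<in> End_part L smul V p"
      "v \<in> V p \<Longrightarrow> mode_plus_minus Y v n \<in> End_part L smul V p"
      "v \<in> V p \<Longrightarrow> mode_plus Y v n \<in> End_part L smul V (p + 1)"
      "v \<in> V p \<Longrightarrow> mode_minus Y v n \<in> End_part L smul V (p + 1)"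
    and truncation: "\<exists>N. \<forall>n\<ge>N. mode Y u n v = 0 \<and> mode_plus_minus Y u n v = 0 \<and>
      mode_plus Y u n v = 0 \<and> mode_minus Y u n v = 0"
    and vacuum: "Y vac S k v = (if S = {} \<and> k = 0 then v else 0)"
    and creation: "k < 0 \<Longrightarrow> Y v S k vac = 0" "Y v {} 0 vac = v"
    and jacobi: "u \<in> V p \<Longrightarrow> v \<in> V q \<Longrightarrow>
      scale_series smul (delta_series X0 1 X1 X2 (- nu))
        (op_apply smul V (Y_at smul Y X1 (gen Phi1P) (gen Phi1M) u)
          (\<lambda>K T. Y_at smul Y X2 (gen Phi2P) (gen Phi2M) v K T w)) K T
      - psign (p * q)
        (scale_series smul (delta_series X0 (- 1) X2 X1 nu)
          (op_apply smul V (Y_at smul Y X2 (gen Phi2P) (gen Phi2M) v)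
            (\<lambda>K T. Y_at smul Y X1 (gen Phi1P) (gen Phi1M) u K T w)) K T)
      = scale_series smul (delta_series X2 1 X1 X0 (- nu))
          (Y_series smul Y X2 (gen Phi2P) (gen Phi2M)
            (\<lambda>K T. Y_at smul Y X0 (gen Phi1P - gen Phi2P) (gen Phi1M - gen Phi2M) u K T v) w) K T"

context N2_vertex_superalgebra
begin

lemma minus_one_Lam: "- 1 \<in> Lam_part L 0"
  by (auto simp: Lam_part_def Lam_def uminus_grassmann.rep_eq one_grassmann.rep_eq split: if_splits)

lemma gconst_Lam: "gconst c \<in> Lam_part L 0"
  by (auto simp: Lam_part_def Lam_def gconst.rep_eq split: if_splits)

lemma Lam_part_Lam: "a \<in> Lam_part L i \<Longrightarrow> a \<in> Lam L"
  by (simp add: Lam_part_def)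

lemma smul_zero: "a \<in> Lam L \<Longrightarrow> smul a 0 = 0"
  using smul_add_right[of a 0 0] by simp

lemma smul_uminus: "a \<in> Lam L \<Longrightarrow> smul a (- v) = - smul a v"
  using smul_add_right[of a v "- v"] smul_zero[of a] by (simp add: eq_neg_iff_add_eq_0 add.commute)

lemma smul_minus_one: "smul (- 1) v = - v"
proof -
  have 1: "1 \<in> Lam L" "- 1 \<in> Lam L" "0 \<in> Lam L"
    using minus_one_Lam
    by (auto simp: Lam_part_def Lam_def one_grassmann.rep_eq zero_grassmann.rep_eq)
  have "smul 0 v = 0" using smul_add_left[of 0 0 v] 1 by simp
  then show ?thesis
    using smul_add_left[of "- 1" 1 v] 1 by (simp add: smul_one eq_neg_iff_add_eq_0)
qed

lemma part_uminus: "v \<in> V j \<Longrightarrow> - v \<in> V j"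
  using part_smul[OF minus_one_Lam, of v j] by (simp only: smul_minus_one add_0)

lemma part_psign: "v \<in> V j \<Longrightarrow> psign p v \<in> V j"
  by (simp add: psign_def part_uminus)

lemma part_unique:
  assumes "a \<in> V 0" "b \<in> V 1" "c \<in> V 0" "d \<in> V 1" "a + b = c + d"
  shows "a = c \<and> b = d"
proof -
  have "a - c = d - b" using assms(5) by (simp add: algebra_simps)
  moreover have "a - c \<in> V 0" using part_add[OF assms(1) part_uminus[OF assms(3)]] by simp
  moreover have "d - b \<in> V 1" using part_add[OF assms(4) part_uminus[OF assms(2)]] by simp
  ultimately have "d - b \<in> V 0 \<inter> V 1" by simp
  then have "d - b = 0" unfolding part_direct by blast
  then have "a - c = 0" "d - b = 0" using \<open>a - c = d - b\<close> by simp_all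
  then show ?thesis by simp
qed

lemma vac_even: "vac \<in> V 0"
proof -
  obtain e f where ef: "e \<in> V 0" "f \<in> V 1" "vac = e + f" using part_span by blast
  let ?e = "mode Y e (- 1)" and ?f = "mode Y f (- 1)"
  have E: "?e \<in> End_part L smul V 0" "?f \<in> End_part L smul V 1"
    using mode_parity(1) ef by blast+
  have s: "?e w + ?f w = w" for w
    using Y_add[of e f "{}" 0 w] vacuum[of "{}" 0 w] ef by (simp add: mode_def)
  have z: "?f w = 0" if "w \<in> V i" for w i
  proof -
    have "?e w \<in> V (0 + i)" "?f w \<in> V (1 + i)" using E that unfolding End_part_def by blast+
    then show ?thesis
      using part_unique[of "?e w" "?f w" w 0] part_unique[of "?f w" "?e w" 0 w]
        s[of w] that part_zero by (cases i) (auto simp: add.commute)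
  qed
  have "?f vac = ?f e + ?f f" using E ef by (simp add: End_part_def)
  also have "\<dots> = 0" using z ef by auto
  finally have "f = 0" using creation(2)[of f] by (simp add: mode_def)
  then show ?thesis using ef by simp
qed

text \<open>The maps \<open>\<D>\<^sup>\<plusminus>\<close> are odd endomorphisms, and \<open>\<D>\<close> is an even one.\<close>

lemma mode_vac_End:
  assumes "S = {PhiP} \<or> S = {PhiM}"
  shows "(\<lambda>v. Y v S k vac) \<in> End_part L smul V 1"
proof -
  have "card S = 1" using assms by auto
  moreover have "Y v S k vac \<in> V (1 + i)" if "v \<in> V i" for v i
  proof -
    have "Y v S k \<in> End_part L smul V (i + 1)"
      using mode_parity(3,4)[OF that, of "- k - 1"] assms
      by (auto simp: mode_plus_def mode_minus_def)
    then have "Y v S k vac \<in> V (i + 1 + 0)" using vac_even unfolding End_part_def by blast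
    then show ?thesis by (simp add: add.commute)
  qed
  ultimately show ?thesis by (simp add: End_part_def Y_add Y_smul)
qed

lemma D_plus_End: "(\<lambda>v. mode_plus Y v n vac) \<in> End_part L smul V 1"
  unfolding mode_plus_def by (rule mode_vac_End) simp

lemma D_minus_End: "(\<lambda>v. mode_minus Y v n vac) \<in> End_part L smul V 1"
  unfolding mode_minus_def by (rule mode_vac_End) simp

lemma supercomm_End:
  assumes A: "A \<in> End_part L smul V 1" and B: "B \<in> End_part L smul V 1"
  shows "(\<lambda>v. smul (gconst c) (supercomm 1 1 A B v)) \<in> End_part L smul V 0"
proof -
  have c: "gconst c \<in> Lam L" using gconst_Lam Lam_part_Lam by blast
  have sc: "supercomm 1 1 A B v = A (B v) + B (A v)" for v
    by (simp add: supercomm_def psign_def)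
  have neg: "T (- v) = - T v" if "T \<in> End_part L smul V 1" for T v
  proof -
    have "T (smul (- 1) v) = psign (0 * 1) (smul (- 1) (T v))"
      using that minus_one_Lam unfolding End_part_def by blast
    then show ?thesis by (simp add: smul_minus_one psign_def)
  qed
  have T2: "A' (B' (smul a v)) = smul a (A' (B' v))"
    if "A' \<in> End_part L smul V 1" "B' \<in> End_part L smul V 1" "a \<in> Lam_part L i" for A' B' a i v
  proof -
    have "B' (smul a v) = psign i (smul a (B' v))" "A' (smul a (B' v)) = psign i (smul a (A' (B' v)))"
      using that by (auto simp: End_part_def)
    then show ?thesis using neg[OF that(1)] by (auto simp: psign_def)
  qed
  have comm: "smul (gconst c) (smul a v) = smul a (smul (gconst c) v)" if "a \<in> Lam_part L i" for a v i
  proof -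
    have "gconst c * a = a * gconst c"
    proof (rule grassmann_eqI)
      fix S :: "nat set"
      show "gcoeff (gconst c * a) S = gcoeff (a * gconst c) S"
      proof (cases "finite S")
        case True
        have "gcoeff (gconst c * a) S = (\<Sum>A\<in>Pow S. if A = {} then c * gcoeff a S else 0)"
          unfolding gcoeff_times by (rule sum.cong) (auto simp: gconst.rep_eq)
        moreover have "gcoeff (a * gconst c) S = (\<Sum>A\<in>Pow S. if A = S then c * gcoeff a S else 0)"
          unfolding gcoeff_times by (rule sum.cong) (auto simp: gconst.rep_eq)
        ultimately show ?thesis using True by simp
      qed (simp add: gcoeff_infinite)
    qed
    then show ?thesis using c Lam_part_Lam[OF that] by (metis smul_smul)
  qed
  have par: "A' (B' v) \<in> V i"
    if "A' \<in> End_part L smul V 1" "B' \<in> End_part L smul V 1" "v \<in> V i" for A' B' v i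
  proof -
    have "A' (B' v) \<in> V (1 + (1 + i))" using that unfolding End_part_def by blast
    then show ?thesis by (cases i) auto
  qed
  show ?thesis
    unfolding End_part_def mem_Collect_eq
  proof (intro conjI allI ballI, goal_cases)
    case (1 v w)
    have "A (v + w) = A v + A w" "B (v + w) = B v + B w"
      "A (B v + B w) = A (B v) + A (B w)" "B (A v + A w) = B (A v) + B (A w)"
      using A B by (simp_all add: End_part_def)
    then show ?case using c by (simp add: sc smul_add_right)
  next
    case (2 i a v)
    then show ?case
      using T2[OF A B] T2[OF B A] comm smul_add_right[OF Lam_part_Lam[OF 2]]
      by (simp add: sc psign_def) (metis Lam_part_Lam smul_add_right)
  next
    case (3 i v)
    then show ?case
      using part_smul[OF gconst_Lam part_add[OF par[OF A B] par[OF B A]]] by (simp add: sc)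
  qed
qed

end

end

theory Submission
  imports Defs
begin

text \<open>
  In the Jacobi identity with \<open>v = \<one>\<close>, taking the residue in \<open>x\<^sub>1\<close> gives
  \<open>Y (u, (x\<^sub>2 + x\<^sub>0 + \<nu>, \<phi>\<^sub>1)) = Y (Y (u, (x\<^sub>0, \<phi>\<^sub>1 - \<phi>\<^sub>2)) \<one>, (x\<^sub>2, \<phi>\<^sub>2))\<close>
  with \<open>\<nu> = \<phi>\<^sub>1\<^sup>+ \<phi>\<^sub>2\<^sup>- + \<phi>\<^sub>1\<^sup>- \<phi>\<^sub>2\<^sup>+\<close>, and only monomials of degree at most two in the odd variables are
  needed. Substituting \<open>\<phi>\<^sub>1 = \<phi>\<^sub>2\<close> kills \<open>\<nu>\<close>, and the coefficient of \<open>x\<^sub>0\<close> then says that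
  \<open>Y (u\<^sub>-\<^sub>2 \<one>)\<close> is the \<open>x\<close>-derivative of \<open>Y u\<close>. Applied to \<open>\<one>\<close> at \<open>x\<^sub>0 = x\<^sub>2 = 0\<close>, the coefficients of
  \<open>\<phi>\<^sub>1\<^sup>+ \<phi>\<^sub>2\<^sup>-\<close> and \<open>\<phi>\<^sub>1\<^sup>- \<phi>\<^sub>2\<^sup>+\<close> express \<open>u\<^sub>-\<^sub>2 \<one>\<close> as \<open>\<D>\<^sup>-\<D>\<^sup>+ u - E u\<close> and as \<open>\<D>\<^sup>+\<D>\<^sup>- u + E u\<close>,
  where \<open>E u\<close> comes from the \<open>\<phi>\<^sup>+\<phi>\<^sup>-\<close>-part of \<open>Y u \<one>\<close>; the average is \<open>\<D> u\<close>.
\<close>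

section \<open>Coefficients of products in the odd variables, up to degree two\<close>

lemma gcoeff_times_empty: "gcoeff (a * b) {} = gcoeff a {} * gcoeff b {}"
  by (simp add: gcoeff_times)

lemma gcoeff_times_single:
  "gcoeff (a * b) {x} = gcoeff a {} * gcoeff b {x} + gcoeff a {x} * gcoeff b {}"
  by (simp add: gcoeff_times Pow_insert)

lemma gsign_single: "gsign {x} {y} = (if y < x then - 1 else 1)"
proof -
  have "{(a, b) \<in> {x} \<times> {y}. b < a} = (if y < x then {(x, y)} else {})" by auto
  then show ?thesis by (simp add: gsign_def)
qed

text \<open>Among the four splittings only the one with \<open>y\<close> in the left factor involves
  an interchange, hence the single minus sign.\<close>

lemma gcoeff_times_pair:
  assumes "x < y"
  shows "gcoeff (a * b) {x, y} = gcoeff a {} * gcoeff b {x, y} + gcoeff a {x} * gcoeff b {y}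
    - gcoeff a {y} * gcoeff b {x} + gcoeff a {x, y} * gcoeff b {}"
proof -
  have "Pow {x, y} = {{}, {x}, {y}, {x, y}}" by blast
  moreover have "{x} \<noteq> {y}" "{x} \<noteq> {x, y}" "{y} \<noteq> {x, y}" "{x, y} - {x} = {y}" "{x, y} - {y} = {x}"
    using assms by auto
  moreover have "\<not> y < x" using assms by simp
  ultimately show ?thesis
    using assms by (simp add: gcoeff_times gsign_single)
qed

lemma gcoeff_sum: "gcoeff (sum f A) S = (\<Sum>i\<in>A. gcoeff (f i) S)"
  by (induction A rule: infinite_finite_induct)
    (auto simp: zero_grassmann.rep_eq plus_grassmann.rep_eq)

lemma gcoeff_gconst_times: "gcoeff (gconst c * a) S = c * gcoeff a S"
proof (cases "finite S")
  case True
  have "gcoeff (gconst c * a) S = (\<Sum>A\<in>Pow S. if A = {} then c * gcoeff a S else 0)"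
    unfolding gcoeff_times by (rule sum.cong) (auto simp: gconst.rep_eq)
  then show ?thesis using True by simp
qed (simp add: gcoeff_infinite)

text \<open>Lowest degrees add under multiplication. With \<open>m = 2\<close> this makes high
  powers of the nilpotent part vanish.\<close>

lemma gcoeff_power_low_degree:
  assumes "\<And>S. card S < m \<Longrightarrow> gcoeff a S = 0" "card S < k * m"
  shows "gcoeff (a ^ k) S = 0"
  using assms(2)
proof (induction k arbitrary: S)
  case (Suc k)
  show ?case
  proof (cases "finite S")
    case True
    have "gcoeff a A = 0 \<or> gcoeff (a ^ k) (S - A) = 0" if "A \<subseteq> S" for A
    proof (cases "card A < m")
      case False
      then have "card (S - A) < k * m"
        using that True Suc.prems card_mono[OF True that] by (simp add: card_Diff_subset finite_subset)
      then show ?thesis using Suc.IH by blast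
    qed (use assms(1) in blast)
    then show ?thesis unfolding power_Suc gcoeff_times by (intro sum.neutral) force
  qed (simp add: gcoeff_infinite)
qed simp

section \<open>Complex constants inside the ring of scalars\<close>

lemma gconst_add: "gconst (a + b) = gconst a + gconst b"
  by (rule grassmann_eqI) (simp add: gconst.rep_eq plus_grassmann.rep_eq)

lemma gconst_mult: "gconst (a * b) = gconst a * gconst b"
  by (rule grassmann_eqI) (simp add: gcoeff_gconst_times gconst.rep_eq)

lemma gconst_0: "gconst 0 = 0"
  by (rule grassmann_eqI) (simp add: gconst.rep_eq zero_grassmann.rep_eq)

lemma gconst_1: "gconst 1 = 1"
  by (rule grassmann_eqI) (simp add: gconst.rep_eq one_grassmann.rep_eq)

lemma gconst_uminus: "gconst (- a) = - gconst a"
  using gconst_add[of a "- a"] by (simp add: gconst_0 eq_neg_iff_add_eq_0 add.commute)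

text \<open>Reconciles \<open>ddx\<close>, which multiplies by \<open>of_int\<close> in the ring of
  scalars, with the computations below, which use complex constants.\<close>

lemma gconst_of_int: "gconst (of_int k) = of_int k"
proof -
  have nat: "gconst (of_nat n) = of_nat n" for n
    by (induction n) (simp_all add: gconst_0 gconst_add gconst_1)
  then show ?thesis by (cases k rule: int_cases2) (simp_all add: gconst_uminus)
qed

section \<open>Generators, \<open>nu\<close>, and Taylor expansion in a nilpotent element\<close>

lemma gcoeff_gen: "gcoeff (gen g) {} = 0" "gcoeff (gen g) {x} = (if x = g then 1 else 0)"
    "x \<noteq> y \<Longrightarrow> gcoeff (gen g) {x, y} = 0"
  by (auto simp: gen.rep_eq)

lemma gcoeff_one: "gcoeff 1 S = (if S = {} then 1 else 0)"
  by (simp add: one_grassmann.rep_eq)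

lemma gcoeff_diff: "gcoeff (a - b) S = gcoeff a S - gcoeff b S"
  unfolding minus_grassmann_def plus_grassmann.rep_eq uminus_grassmann.rep_eq by simp

lemma gcoeff_nu_low_degree: "card S < 2 \<Longrightarrow> gcoeff nu S = 0"
  by (auto simp: nu_def plus_grassmann.rep_eq gcoeff_gen_times)

lemma card_ovar_set: "card (S :: ovar set) \<le> 4"
proof -
  have U: "(UNIV :: ovar set) = {Phi1P, Phi1M, Phi2P, Phi2M}" by (auto intro: ovar.exhaust)
  have "card S \<le> card {Phi1P, Phi1M, Phi2P, Phi2M}"
    by (rule card_mono) (use U in auto)
  then show ?thesis by simp
qed

lemma gcoeff_pow_diff_nil:
  assumes "\<And>S. card S < 2 \<Longrightarrow> gcoeff \<nu> S = 0"
  shows "gcoeff (pow_diff_nil n \<nu> p q) A =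
    (\<Sum>k\<le>2. (of_int n gchoose k) * pow_diff (n - int k) p q * gcoeff (\<nu> ^ k) A)"
proof -
  \<comment> \<open>With four odd variables no monomial has degree above 4, while the third power of
    \<nu> starts in degree 6.\<close>
  have "\<nu> ^ k = 0" if "k > 2" for k
  proof (rule grassmann_eqI)
    fix S :: "ovar set"
    have "card S < k * 2" using card_ovar_set[of S] that by simp
    then show "gcoeff (\<nu> ^ k) S = gcoeff 0 S"
      using gcoeff_power_low_degree[OF assms] by (simp add: zero_grassmann.rep_eq)
  qed
  then have "k \<le> 2" if "\<nu> ^ k \<noteq> 0" for k using that not_le by blast
  then have "{k. \<nu> ^ k \<noteq> 0} \<subseteq> {..2}" by auto
  then have "pow_diff_nil n \<nu> p q =
      (\<Sum>k\<le>2. gconst ((of_int n gchoose k) * pow_diff (n - int k) p q) * \<nu> ^ k)"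
    unfolding pow_diff_nil_def by (intro sum.mono_neutral_left) auto
  then show ?thesis by (simp only: gcoeff_sum gcoeff_gconst_times)
qed

lemma gcoeff_pow_diff_nil_degree_le_2:
  assumes "\<And>S. card S < 2 \<Longrightarrow> gcoeff \<nu> S = 0" "card A \<le> 2"
  shows "gcoeff (pow_diff_nil n \<nu> p q) A =
    (if A = {} then pow_diff n p q else 0) + of_int n * pow_diff (n - 1) p q * gcoeff \<nu> A"
proof -
  \<comment> \<open>The second-order Taylor term starts in degree 4.\<close>
  have "gcoeff (\<nu> ^ 2) A = 0" using assms(2) by (intro gcoeff_power_low_degree[OF assms(1)]) auto
  then show ?thesis
    by (simp add: gcoeff_pow_diff_nil[OF assms(1)] numeral_2_eq_2 gcoeff_one)
qed

lemma gchoose_pred_self: "((of_nat k - 1 :: complex) gchoose k) = (if k = 0 then 1 else 0)"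
proof (cases k)
  case (Suc j)
  have "(of_nat k - 1 :: complex) = of_nat j" by (simp add: Suc)
  then show ?thesis using Suc by (simp add: binomial_gbinomial[symmetric])
qed simp

text \<open>\<open>(y - z + \<nu>)\<^sup>n\<close> contains \<open>y\<^sup>-\<^sup>1\<close> only for \<open>n = -1\<close>, because \<open>(k - 1) choose k\<close> vanishes for
  \<open>k > 0\<close>.\<close>

lemma gcoeff_pow_diff_nil_residue:
  assumes "\<And>S. card S < 2 \<Longrightarrow> gcoeff \<nu> S = 0"
  shows "gcoeff (pow_diff_nil n \<nu> (- 1) q) A = (if n = - 1 \<and> q = 0 \<and> A = {} then 1 else 0)"
proof -
  have "(of_int n gchoose k) * pow_diff (n - int k) (- 1) q =
      (if n = - 1 \<and> q = 0 \<and> k = 0 then 1 else 0)" for k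
  \<comment> \<open>Outside this case \<open>pow_diff\<close> is zero. Inside it is, up to sign, q -
    1 choose q, which forces q = 0; then n = k - 1, and the Taylor coefficient k - 1 choose k forces
    k = 0.\<close>
  proof (cases "0 \<le> q \<and> q - 1 = n - int k")
    case True
    then have n: "n = q - 1 + int k" "q = int (nat q)" by auto
    have "(of_int (n - int k) :: complex) = of_nat (nat q) - 1"
      using n by (metis add_diff_cancel_right' of_int_1 of_int_diff of_int_of_nat_eq)
    then have "pow_diff (n - int k) (- 1) q = (if q = 0 then 1 else 0)"
      using True gchoose_pred_self[of "nat q"] by (auto simp: pow_diff_def)
    moreover have "((of_int n :: complex) gchoose k) = (if k = 0 then 1 else 0)" if "q = 0"
      using gchoose_pred_self[of k] n(1) that by simp
    ultimately show ?thesis using n by auto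
  qed (auto simp: pow_diff_def)
  then show ?thesis
    by (auto simp: gcoeff_pow_diff_nil[OF assms] gcoeff_one numeral_2_eq_2)
qed

section \<open>The delta series at a single exponent\<close>

lemma delta_series_X0:
  "delta_series X0 \<epsilon> X1 X2 \<nu> (a, b, c) = gconst (\<epsilon> powi (a + 1)) * pow_diff_nil (- a - 1) \<nu> b c"
  "delta_series X0 \<epsilon> X2 X1 \<nu> (a, b, c) = gconst (\<epsilon> powi (a + 1)) * pow_diff_nil (- a - 1) \<nu> c b"
proof -
  have "{(n, p, q). X0 (- n - 1) + X1 p + X2 q = (a, b, c)} = {(- a - 1, b, c)}"
    "{(n, p, q). X0 (- n - 1) + X2 p + X1 q = (a, b, c)} = {(- a - 1, c, b)}"
    by (auto simp: X0_def X1_def X2_def)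
  then show
    "delta_series X0 \<epsilon> X1 X2 \<nu> (a, b, c) = gconst (\<epsilon> powi (a + 1)) * pow_diff_nil (- a - 1) \<nu> b c"
    "delta_series X0 \<epsilon> X2 X1 \<nu> (a, b, c) = gconst (\<epsilon> powi (a + 1)) * pow_diff_nil (- a - 1) \<nu> c b"
    by (simp_all add: delta_series_def add.commute)
qed

lemma delta_series_X2:
  "delta_series X2 \<epsilon> X1 X0 \<nu> (a, b, c) = gconst (\<epsilon> powi (c + 1)) * pow_diff_nil (- c - 1) \<nu> b a"
proof -
  have "{(n, p, q). X2 (- n - 1) + X1 p + X0 q = (a, b, c)} = {(- c - 1, b, a)}"
    by (auto simp: X0_def X1_def X2_def)
  then show ?thesis by (simp add: delta_series_def add.commute)
qed

section \<open>Evaluation of series at named variables\<close>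

lemma sum_phi_set: "(\<Sum>S\<in>UNIV. f S) = f {} + f {PhiP} + f {PhiM} + f {PhiP, PhiM}"
  for f :: "phi set \<Rightarrow> 'a::comm_monoid_add"
proof -
  have U: "(UNIV :: phi set) = {PhiP, PhiM}" by (auto intro: phi.exhaust)
  have "(UNIV :: phi set set) = Pow {PhiP, PhiM}" unfolding U[symmetric] by simp
  also have "\<dots> = {{}, {PhiP}, {PhiM}, {PhiP, PhiM}}" by blast
  finally have P: "(UNIV :: phi set set) = {{}, {PhiP}, {PhiM}, {PhiP, PhiM}}" .
  have "{PhiP} \<noteq> {PhiM}" "{PhiP} \<noteq> {PhiP, PhiM}" "{PhiM} \<noteq> {PhiP, PhiM}" by auto
  then show ?thesis unfolding P by (simp add: add.assoc)
qed

lemma phi_set_cases: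
  obtains "S = {}" | "S = {PhiP}" | "S = {PhiM}" | "S = {PhiP, PhiM}"
  by (metis phi.exhaust insert_iff empty_iff subsetI subset_antisym)

lemma inj_X: "inj X0" "inj X1" "inj X2"
  by (auto simp: inj_def X0_def X1_def X2_def)

text \<open>The factor inside \<open>at_vars\<close>, named so that products of two such monomials
  can be formed in the Grassmann algebra.\<close>

definition phi_mono :: "ovar grassmann \<Rightarrow> ovar grassmann \<Rightarrow> phi set \<Rightarrow> ovar grassmann" where
  "phi_mono \<alpha> \<beta> S = (if PhiP \<in> S then \<alpha> else 1) * (if PhiM \<in> S then \<beta> else 1)"

lemma at_vars_eq:
  "inj x \<Longrightarrow> at_vars smul x \<alpha> \<beta> f (x k) T =
    (\<Sum>S\<in>UNIV. smul (gconst (gcoeff (phi_mono \<alpha> \<beta> S) T)) (f S k))"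
proof -
  assume "inj x"
  then have "{(k', S). x k' = x k} = {k} \<times> (UNIV :: phi set set)" by (auto dest: injD)
  then show ?thesis
    by (simp add: at_vars_def phi_mono_def sum.cartesian_product[symmetric])
qed

lemma at_vars_zero: "K \<notin> range x \<Longrightarrow> at_vars smul x \<alpha> \<beta> f K T = 0"
proof -
  assume "K \<notin> range x"
  then have "{(k, S). x k = K} = ({} :: (int \<times> phi set) set)" by auto
  then show ?thesis by (simp only: at_vars_def sum.empty)
qed

lemma Sum_any_single:
  assumes "\<And>a. a \<noteq> b \<Longrightarrow> f a = 0"
  shows "Sum_any f = f b"
proof -
  have "Sum_any f = sum f {b}" by (rule Sum_any.expand_superset) (use assms in auto)
  then show ?thesis by simp
qed

context graded_module
begin

lemma gconst_in_Lam: "gconst c \<in> Lam L"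
  by (auto simp: Lam_def gconst.rep_eq split: if_splits)

text \<open>The ring of scalars is not commutative in general, but the constants are complex numbers
  and lie in \<open>Lam L\<close>; restricted to them, \<open>smul\<close> obeys the usual module
  laws.\<close>

sublocale scalar: module "\<lambda>c. smul (gconst c)"
  by unfold_locales
    (simp_all add: smul_add_right smul_add_left smul_smul[symmetric] smul_one gconst_in_Lam
      gconst_add gconst_mult gconst_1)

end

section \<open>Zero vectors and the parity involution\<close>

context N2_vertex_superalgebra
begin

lemma Y_zero: "Y 0 S k w = 0"
  using Y_add[of 0 0 S k w] by simp

lemma Y_scale: "Y (smul (gconst c) v) S k w = smul (gconst c) (Y v S k w)"
  using Y_smul[OF gconst_Lam, of c v S k w] by (simp add: psign_def)

lemma Y_sum: "Y (\<Sum>i\<in>A. f i) S k w = (\<Sum>i\<in>A. Y (f i) S k w)"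
  by (induction A rule: infinite_finite_induct) (simp_all add: Y_zero Y_add)

lemma par_inv_parts:
  assumes "a \<in> V 0" "b \<in> V 1"
  shows "par_inv V (a + b) = a - b"
proof -
  have "(THE v0. v0 \<in> V 0 \<and> a + b - v0 \<in> V 1) = a"
  proof (rule the_equality)
    fix c assume c: "c \<in> V 0 \<and> a + b - c \<in> V 1"
    have "c = a \<and> a + b - c = b" by (rule part_unique) (use c assms in simp_all)
    then show "c = a" ..
  qed (use assms in simp)
  then show ?thesis unfolding par_inv_def by simp
qed

lemma par_inv_par_inv: "par_inv V (par_inv V v) = v"
proof -
  obtain a b where ab: "a \<in> V 0" "b \<in> V 1" "v = a + b" using part_span by blast
  then show ?thesis using par_inv_parts[of a "- b"] by (simp add: par_inv_parts part_uminus)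
qed

lemma past_id: "past V n (\<lambda>v. v) v = v"
proof -
  have "(par_inv V ^^ n) ((par_inv V ^^ n) v) = v"
    by (induction n) (simp_all add: funpow_swap1[symmetric] par_inv_par_inv)
  then show ?thesis by (simp add: past_def)
qed

lemma par_inv_zero: "par_inv V 0 = 0"
  using par_inv_parts[of 0 0] part_zero by simp

lemma past_eq_zero:
  assumes "T 0 = 0"
  shows "past V n T 0 = 0"
proof -
  have "(par_inv V ^^ n) 0 = 0" by (induction n) (simp_all add: par_inv_zero)
  then show ?thesis using assms by (simp add: past_def)
qed

lemma past_zero: "past V n (\<lambda>v. 0) v = 0"
proof -
  have "(par_inv V ^^ n) 0 = 0" by (induction n) (simp_all add: par_inv_zero)
  then show ?thesis by (simp add: past_def)
qed

text \<open>Additivity in the argument is read off from the parity condition, which concerns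
  homogeneous \<open>u\<close>.\<close>

lemma Y_apply_zero:
  assumes "u \<in> V p"
  shows "Y u S k 0 = 0"
proof -
  have "\<exists>j. Y u S k \<in> End_part L smul V j"
    using mode_parity[OF assms, of "- k - 1"]
    by (cases S rule: phi_set_cases)
      (auto simp: mode_def mode_plus_def mode_minus_def mode_plus_minus_def)
  then have "Y u S k (0 + 0) = Y u S k 0 + Y u S k 0" unfolding End_part_def by blast
  then show ?thesis by simp
qed

lemma Y_at_apply_zero:
  assumes "inj x" "u \<in> V p"
  shows "Y_at smul Y x \<alpha> \<beta> u K T 0 = 0"
proof (cases "K \<in> range x")
  case True
  then show ?thesis using assms by (auto simp: Y_at_def at_vars_eq Y_apply_zero)
qed (simp add: Y_at_def at_vars_zero)

section \<open>Products with the vacuum operator\<close>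

lemma Y_at_vac:
  assumes "inj x" "x 0 = 0"
  shows "Y_at smul Y x \<alpha> \<beta> vac K T w = (if K = 0 \<and> T = {} then w else 0)"
proof (cases "K \<in> range x")
  case True
  then obtain k where k: "K = x k" by blast
  have "k = 0 \<longleftrightarrow> x k = 0" using assms by (metis injD)
  then show ?thesis
    unfolding k by (simp add: Y_at_def at_vars_eq[OF assms(1)] sum_phi_set vacuum phi_mono_def
      gcoeff_one)
next
  case False
  then have "K \<noteq> 0" using assms(2) by force
  then show ?thesis using False by (simp add: Y_at_def at_vars_zero)
qed

lemma op_apply_vac_right:
  assumes "inj x" "x 0 = 0" "\<And>K T. G K T 0 = 0" "finite T"
  shows "op_apply smul V G (\<lambda>K T. Y_at smul Y x \<alpha> \<beta> vac K T w) K T = G K T w"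
proof -
  let ?f = "\<lambda>K' A. smul (gconst (gsign A (T - A))) (past V (card (T - A)) (G K' A)
    (Y_at smul Y x \<alpha> \<beta> vac (K - K') (T - A) w))"
  \<comment> \<open>The vacuum series sits at exponent 0 without odd variables, so all these terms
    apply \<open>G\<close> to 0. In the surviving term \<open>T - A\<close> is empty, so neither a
    sign nor a conjugation remains.\<close>
  have z: "?f K' A = 0" if "K' \<noteq> K \<or> A \<noteq> T" "A \<subseteq> T" for K' A
  proof -
    have "Y_at smul Y x \<alpha> \<beta> vac (K - K') (T - A) w = 0"
      using that by (auto simp: Y_at_vac[OF assms(1,2)])
    then show ?thesis using past_eq_zero[of "G K' A"] assms(3) by simp
  qed
  have "(\<Sum>A\<in>Pow T. ?f K' A) = 0" if "K' \<noteq> K" for K'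
    by (intro sum.neutral ballI z) (use that in auto)
  then have "op_apply smul V G (\<lambda>K T. Y_at smul Y x \<alpha> \<beta> vac K T w) K T = (\<Sum>A\<in>Pow T. ?f K A)"
    unfolding op_apply_def by (rule Sum_any_single)
  also have "\<dots> = (\<Sum>A\<in>{T}. ?f K A)"
    using assms(4) by (intro sum.mono_neutral_right ballI z) auto
  finally show ?thesis by (simp add: Y_at_vac[OF assms(1,2)] past_def)
qed

lemma op_apply_vac_left:
  assumes "inj x" "x 0 = 0" "finite T"
  shows "op_apply smul V (Y_at smul Y x \<alpha> \<beta> vac) F K T = F K T"
proof -
  let ?f = "\<lambda>K' A. smul (gconst (gsign A (T - A)))
    (past V (card (T - A)) (Y_at smul Y x \<alpha> \<beta> vac K' A) (F (K - K') (T - A)))"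
  have vac: "Y_at smul Y x \<alpha> \<beta> vac K' A = (if K' = 0 \<and> A = {} then \<lambda>v. v else (\<lambda>v. 0))" for K' A
    by (rule ext) (simp add: Y_at_vac[OF assms(1,2)])
  have z: "?f K' A = 0" if "K' \<noteq> 0 \<or> A \<noteq> {}" for K' A
    using that by (auto simp: vac past_zero)
  have "(\<Sum>A\<in>Pow T. ?f K' A) = 0" if "K' \<noteq> 0" for K'
    by (intro sum.neutral ballI z) (use that in auto)
  then have "op_apply smul V (Y_at smul Y x \<alpha> \<beta> vac) F K T = (\<Sum>A\<in>Pow T. ?f 0 A)"
    unfolding op_apply_def by (rule Sum_any_single)
  also have "\<dots> = (\<Sum>A\<in>{{}}. ?f 0 A)"
    using assms(3) by (intro sum.mono_neutral_right ballI z) auto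
  finally show ?thesis by (simp add: vac past_id)
qed

section \<open>Residues in x_1\<close>

lemma scale_series_X1:
  assumes d: "\<And>b A. card A \<le> 2 \<Longrightarrow> gcoeff (d (k0, b, k2)) A =
      (if A = {} \<and> b = m then c0 else 0) + (if b = m - 1 then c1 * gcoeff nu A else 0)"
    and F: "\<And>K A. K \<notin> range X1 \<Longrightarrow> F K A = 0"
    and T: "card T \<le> 2"
  shows "scale_series smul d F (k0, - 1, k2) T =
    smul (gconst c0) (F (X1 (- 1 - m)) T) + smul (gconst (c1 * gcoeff nu T)) (F (X1 (- m)) {})"
proof -
  let ?f = "\<lambda>K' A. smul (gconst (gsign A (T - A) * gcoeff (d K') A)) (F ((k0, - 1, k2) - K') (T - A))"
  have cA: "card A \<le> 2" if "A \<subseteq> T" for A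
    using card_mono[of T A] that T by (simp add: finite_subset)
  have fT: "finite T" by simp
  \<comment> \<open>Since \<open>F\<close> lives on powers of x_1, only the x_1-exponent of
    \<open>K'\<close> is free, and \<open>d\<close> admits there only \<open>m\<close> (order 0 in
    \<open>nu\<close>) and \<open>m - 1\<close> (order 1).\<close>
  have z: "?f K' A = 0" if "A \<subseteq> T" "K' \<notin> {(k0, m, k2), (k0, m - 1, k2)}" for K' A
  proof (cases "(k0, - 1, k2) - K' \<in> range X1")
    case True
    then obtain b where "K' = (k0, b, k2)" by (cases K') (auto simp: X1_def)
    then show ?thesis using that d[OF cA[OF that(1)]] by auto
  qed (simp add: F)
  have nuA: "gcoeff nu A = 0" if "A \<subseteq> T" "A \<noteq> T" for A
  proof -
    have "card A < card T" using that by (intro psubset_card_mono) auto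
    then show ?thesis using T by (intro gcoeff_nu_low_degree) simp
  qed
  have "scale_series smul d F (k0, - 1, k2) T =
      (\<Sum>K'\<in>{(k0, m, k2), (k0, m - 1, k2)}. \<Sum>A\<in>Pow T. ?f K' A)"
    unfolding scale_series_def
  proof (rule Sum_any.expand_superset)
    show "{K'. (\<Sum>A\<in>Pow T. ?f K' A) \<noteq> 0} \<subseteq> {(k0, m, k2), (k0, m - 1, k2)}"
    proof
      fix K' assume "K' \<in> {K'. (\<Sum>A\<in>Pow T. ?f K' A) \<noteq> 0}"
      then obtain A where "A \<in> Pow T" "?f K' A \<noteq> 0"
        by (metis (mono_tags, lifting) mem_Collect_eq sum.neutral)
      then show "K' \<in> {(k0, m, k2), (k0, m - 1, k2)}" using z by blast
    qed
  qed simp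
  also have "\<dots> = (\<Sum>A\<in>Pow T. ?f (k0, m, k2) A) + (\<Sum>A\<in>Pow T. ?f (k0, m - 1, k2) A)"
    by simp
  \<comment> \<open>At \<open>m\<close> only the constant part of \<open>d\<close> remains. At
    \<open>m - 1\<close> it is a multiple of \<open>nu\<close>, which has no terms below degree 2,
    so all of \<open>T\<close> goes to \<open>d\<close>.\<close>
  also have "(\<Sum>A\<in>Pow T. ?f (k0, m, k2) A) = (\<Sum>A\<in>{{}}. ?f (k0, m, k2) A)"
    using d[OF cA] by (intro sum.mono_neutral_right) auto
  also have "(\<Sum>A\<in>Pow T. ?f (k0, m - 1, k2) A) = (\<Sum>A\<in>{T}. ?f (k0, m - 1, k2) A)"
    using d[OF cA] nuA by (intro sum.mono_neutral_right) auto
  finally show ?thesis using d[of "{}" m] d[OF T, of "m - 1"] by (simp add: X1_def)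
qed

text \<open>As \<open>G\<close> is free of x_1, the residue falls on the delta factor, where it
  equals 1: only the power \<open>n = - 1\<close> contributes, and it carries x_2 to the power
  0.\<close>

lemma scale_series_residue:
  assumes "\<And>a b c A. b \<noteq> 0 \<Longrightarrow> G (a, b, c) A = 0"
  shows "scale_series smul (delta_series X2 1 X1 X0 (- nu)) G (k0, - 1, k2) T = G (k0, 0, k2) T"
proof -
  let ?d = "delta_series X2 1 X1 X0 (- nu)"
  let ?f = "\<lambda>K' A. smul (gconst (gsign A (T - A) * gcoeff (?d K') A)) (G ((k0, - 1, k2) - K') (T - A))"
  have d: "gcoeff (?d (a, - 1, c)) A = (if a = 0 \<and> c = 0 \<and> A = {} then 1 else 0)" for a c A
    unfolding delta_series_X2 gcoeff_gconst_times
    by (subst gcoeff_pow_diff_nil_residue) (auto simp: uminus_grassmann.rep_eq gcoeff_nu_low_degree)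
  have z: "?f K' A = 0" if "K' \<noteq> (0, - 1, 0) \<or> A \<noteq> {}" for K' A
  proof -
    obtain a b c where K': "K' = (a, b, c)" by (cases K')
    show ?thesis
    proof (cases "b = - 1")
      case True
      then show ?thesis using that by (auto simp: K' d)
    qed (simp add: K' assms)
  qed
  have "(\<Sum>A\<in>Pow T. ?f K' A) = 0" if "K' \<noteq> (0, - 1, 0)" for K'
    by (intro sum.neutral ballI z) (use that in blast)
  then have "scale_series smul ?d G (k0, - 1, k2) T = (\<Sum>A\<in>Pow T. ?f (0, - 1, 0) A)"
    unfolding scale_series_def by (rule Sum_any_single)
  also have "\<dots> = (\<Sum>A\<in>{{}}. ?f (0, - 1, 0) A)"
    by (intro sum.mono_neutral_right ballI z) auto
  finally show ?thesis by (simp add: d)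
qed

section \<open>The iterated operator\<close>

lemma Y_at_zero: "Y_at smul Y x \<alpha> \<beta> 0 K T w = 0"
  by (simp add: Y_at_def at_vars_def Y_zero case_prod_beta)

lemma Y_series_term_zero:
  assumes "K' \<noteq> X0 k0 \<or> b \<noteq> 0"
  shows "Y_at smul Y X2 \<alpha>' \<beta>' (Y_at smul Y X0 \<alpha> \<beta> u K' A v) ((k0, b, k2) - K') B w = 0"
proof (cases "K' \<in> range X0")
  case True
  then have "(k0, b, k2) - K' \<notin> range X2" using assms by (auto simp: X0_def X2_def)
  then show ?thesis by (simp add: Y_at_def at_vars_zero)
next
  case False
  then have "Y_at smul Y X0 \<alpha> \<beta> u K' A v = 0" by (simp add: Y_at_def at_vars_zero)
  then show ?thesis by (simp add: Y_at_zero)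
qed

lemma Y_series_X1_zero:
  assumes "b \<noteq> 0"
  shows "Y_series smul Y X2 \<alpha>' \<beta>' (\<lambda>K T. Y_at smul Y X0 \<alpha> \<beta> u K T v) w (k0, b, k2) T = 0"
  unfolding Y_series_def using assms
  by (simp add: Y_series_term_zero)

text \<open>The inner operator involves only x_0 and the outer one only x_2, which fixes
  \<open>K'\<close>. The signed sum over \<open>A\<close> is then the coefficient of a product of
  two odd monomials.\<close>

lemma Y_series_iterate:
  "Y_series smul Y X2 \<alpha>' \<beta>' (\<lambda>K T. Y_at smul Y X0 \<alpha> \<beta> u K T v) w (k0, 0, k2) T =
    (\<Sum>S'\<in>UNIV. \<Sum>S\<in>UNIV. smul (gconst (gcoeff (phi_mono \<alpha> \<beta> S' * phi_mono \<alpha>' \<beta>' S) T))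
      (Y (Y u S' k0 v) S k2 w))"
proof -
  let ?f = "\<lambda>K' A. smul (gconst (gsign A (T - A)))
    (Y_at smul Y X2 \<alpha>' \<beta>' (Y_at smul Y X0 \<alpha> \<beta> u K' A v) ((k0, 0, k2) - K') (T - A) w)"
  have "(\<Sum>A\<in>Pow T. ?f K' A) = 0" if "K' \<noteq> X0 k0" for K'
    using that by (intro sum.neutral) (simp add: Y_series_term_zero)
  then have "Y_series smul Y X2 \<alpha>' \<beta>' (\<lambda>K T. Y_at smul Y X0 \<alpha> \<beta> u K T v) w (k0, 0, k2) T =
      (\<Sum>A\<in>Pow T. ?f (X0 k0) A)"
    unfolding Y_series_def by (rule Sum_any_single)
  also have "(k0, 0, k2) - X0 k0 = X2 k2" by (simp add: X0_def X2_def)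
  also have "(\<Sum>A\<in>Pow T. smul (gconst (gsign A (T - A)))
      (Y_at smul Y X2 \<alpha>' \<beta>' (Y_at smul Y X0 \<alpha> \<beta> u (X0 k0) A v) (X2 k2) (T - A) w)) =
    (\<Sum>A\<in>Pow T. \<Sum>S\<in>UNIV. \<Sum>S'\<in>UNIV. smul (gconst (gsign A (T - A) *
      gcoeff (phi_mono \<alpha> \<beta> S') A * gcoeff (phi_mono \<alpha>' \<beta>' S) (T - A))) (Y (Y u S' k0 v) S k2 w))"
    by (simp only: Y_at_def at_vars_eq[OF inj_X(1)] at_vars_eq[OF inj_X(3)] Y_sum Y_scale
        scalar.scale_sum_right scalar.scale_scale mult_ac)
  also have "\<dots> = (\<Sum>S\<in>UNIV. \<Sum>A\<in>Pow T. \<Sum>S'\<in>UNIV. smul (gconst (gsign A (T - A) *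
      gcoeff (phi_mono \<alpha> \<beta> S') A * gcoeff (phi_mono \<alpha>' \<beta>' S) (T - A))) (Y (Y u S' k0 v) S k2 w))"
    by (rule sum.swap)
  also have "\<dots> = (\<Sum>S\<in>UNIV. \<Sum>S'\<in>UNIV. \<Sum>A\<in>Pow T. smul (gconst (gsign A (T - A) *
      gcoeff (phi_mono \<alpha> \<beta> S') A * gcoeff (phi_mono \<alpha>' \<beta>' S) (T - A))) (Y (Y u S' k0 v) S k2 w))"
    by (rule sum.cong[OF refl], rule sum.swap)
  also have "\<dots> = (\<Sum>S'\<in>UNIV. \<Sum>S\<in>UNIV. \<Sum>A\<in>Pow T. smul (gconst (gsign A (T - A) *
      gcoeff (phi_mono \<alpha> \<beta> S') A * gcoeff (phi_mono \<alpha>' \<beta>' S) (T - A))) (Y (Y u S' k0 v) S k2 w))"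
    by (rule sum.swap)
  finally show ?thesis by (simp only: gcoeff_times scalar.scale_sum_left)
qed

text \<open>With \<open>vac\<close> as second vector, both products in the Jacobi identity reduce to
  \<open>Y u\<close>. After taking the residue in x_1, the brackets compare the two expansions of
  the powers \<open>n\<close> and \<open>n - 1\<close> of x_1 - x_2, at orders 0 and 1 in
  \<open>nu\<close>. The plus in the second bracket arises because
  \<open>(- 1) powi (k0 + 1)\<close> has the parity of \<open>n\<close>, not of
  \<open>n - 1\<close>.\<close>

lemma iterate_vac:
  fixes k0 k2 :: int
  defines "n \<equiv> - k0 - 1"
  assumes u: "u \<in> V p" and T: "card T \<le> 2"
  shows "smul (gconst (pow_diff n (n - k2) k2 - (- 1) powi (k0 + 1) * pow_diff n k2 (n - k2)))
      (Y_at smul Y X1 (gen Phi1P) (gen Phi1M) u (X1 (k0 + k2)) T w) +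
    smul (gconst (- of_int n * (pow_diff (n - 1) (n - 1 - k2) k2 +
      (- 1) powi (k0 + 1) * pow_diff (n - 1) k2 (n - 1 - k2)) * gcoeff nu T)) (Y u {} (k0 + k2 + 1) w) =
    (\<Sum>S'\<in>UNIV. \<Sum>S\<in>UNIV. smul (gconst (gcoeff
      (phi_mono (gen Phi1P - gen Phi2P) (gen Phi1M - gen Phi2M) S' *
       phi_mono (gen Phi2P) (gen Phi2M) S) T)) (Y (Y u S' k0 vac) S k2 w))"
proof -
  let ?F = "\<lambda>K T. Y_at smul Y X1 (gen Phi1P) (gen Phi1M) u K T w"
  define d1 where "d1 = delta_series X0 1 X1 X2 (- nu)"
  define d2 where "d2 = delta_series X0 (- 1) X2 X1 nu"
  define a1 where "a1 = pow_diff n (n - k2) k2"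
  define a2 where "a2 = (- 1) powi (k0 + 1) * pow_diff n k2 (n - k2)"
  define c1 where "c1 = - of_int n * pow_diff (n - 1) (n - 1 - k2) k2"
  define c2 where "c2 = (- 1) powi (k0 + 1) * of_int n * pow_diff (n - 1) k2 (n - 1 - k2)"
  have F: "?F K A = 0" if "K \<notin> range X1" for K A
    using that by (simp add: Y_at_def at_vars_zero)
  have F0: "?F (X1 k) {} = Y u {} k w" for k
    by (simp add: Y_at_def at_vars_eq[OF inj_X(2)] sum_phi_set phi_mono_def gcoeff_one gcoeff_gen
        gcoeff_times_empty)
  have r: "op_apply smul V (Y_at smul Y X1 (gen Phi1P) (gen Phi1M) u)
      (\<lambda>K T. Y_at smul Y X2 (gen Phi2P) (gen Phi2M) vac K T w) = ?F"
    by (intro ext op_apply_vac_right) (simp_all add: inj_X X2_def zero_prod_def Y_at_apply_zero[OF _ u])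
  have l: "op_apply smul V (Y_at smul Y X2 (gen Phi2P) (gen Phi2M) vac)
      ?F = ?F"
    by (intro ext op_apply_vac_left) (simp_all add: inj_X X2_def zero_prod_def)
  have g1: "gcoeff (d1 (k0, b, k2)) A = (if A = {} \<and> b = n - k2 then a1 else 0) +
      (if b = n - k2 - 1 then c1 * gcoeff nu A else 0)" if "card A \<le> 2" for b A
    unfolding d1_def delta_series_X0 gcoeff_gconst_times n_def[symmetric]
    by (subst gcoeff_pow_diff_nil_degree_le_2[OF _ that])
      (auto simp: uminus_grassmann.rep_eq gcoeff_nu_low_degree a1_def c1_def pow_diff_def)
  have g2: "gcoeff (d2 (k0, b, k2)) A =
      (if A = {} \<and> b = n - k2 then a2 else 0) +
      (if b = n - k2 - 1 then c2 * gcoeff nu A else 0)" if "card A \<le> 2" for b A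
    unfolding d2_def delta_series_X0 gcoeff_gconst_times n_def[symmetric]
    by (subst gcoeff_pow_diff_nil_degree_le_2[OF gcoeff_nu_low_degree that])
      (auto simp: a2_def c2_def pow_diff_def algebra_simps)
  have e: "- 1 - (n - k2) = k0 + k2" "- (n - k2) = k0 + k2 + 1" by (simp_all add: n_def)
  have "scale_series smul d1 ?F (k0, - 1, k2) T - scale_series smul d2 ?F (k0, - 1, k2) T =
      (\<Sum>S'\<in>UNIV. \<Sum>S\<in>UNIV. smul (gconst (gcoeff
        (phi_mono (gen Phi1P - gen Phi2P) (gen Phi1M - gen Phi2M) S' *
         phi_mono (gen Phi2P) (gen Phi2M) S) T)) (Y (Y u S' k0 vac) S k2 w))"
    \<comment> \<open>Evenness of \<open>vac\<close> makes the exchange sign +1.\<close>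
    using jacobi[OF u vac_even, of w "(k0, - 1, k2)" T]
    by (simp add: r l psign_def d1_def d2_def scale_series_residue Y_series_X1_zero Y_series_iterate)
  moreover have "scale_series smul d1 ?F (k0, - 1, k2) T =
      smul (gconst a1) (?F (X1 (k0 + k2)) T) + smul (gconst (c1 * gcoeff nu T)) (Y u {} (k0 + k2 + 1) w)"
    using scale_series_X1[of d1 k0 k2 "n - k2" a1 c1 ?F T, OF g1 F T] unfolding e F0 .
  moreover have "scale_series smul d2 ?F (k0, - 1, k2) T =
      smul (gconst a2) (?F (X1 (k0 + k2)) T) + smul (gconst (c2 * gcoeff nu T)) (Y u {} (k0 + k2 + 1) w)"
    using scale_series_X1[of d2 k0 k2 "n - k2" a2 c2 ?F T, OF g2 F T] unfolding e F0 .
  moreover have "- of_int n * (pow_diff (n - 1) (n - 1 - k2) k2 +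
      (- 1) powi (k0 + 1) * pow_diff (n - 1) k2 (n - 1 - k2)) * gcoeff nu T =
      c1 * gcoeff nu T - c2 * gcoeff nu T"
    by (simp add: c1_def c2_def algebra_simps)
  ultimately show ?thesis
    unfolding a1_def[symmetric] a2_def[symmetric]
    by (simp only: scalar.scale_left_diff_distrib add_diff_add)
qed

section \<open>Binomial coefficients of the first derivative\<close>

lemma gchoose_minus_2: "((- 2 :: complex) gchoose k) * (- 1) ^ k = of_nat k + 1"
proof -
  have "((- 2 :: complex) gchoose k) = (- 1) ^ k * (of_nat (Suc k) gchoose k)"
    using gbinomial_minus[of "2 :: complex" k] by (simp add: algebra_simps)
  then show ?thesis
    by (simp add: binomial_gbinomial[symmetric] power_mult_distrib[symmetric] del: of_nat_Suc)
       (simp add: add.commute)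
qed

text \<open>The first expansion contributes for k \<ge> 0 and the second for k \<le> -2; at k = -1
  both vanish, as does k + 1.\<close>

lemma pow_diff_minus_2_residue:
  "pow_diff (- 2) (- 2 - k) k - pow_diff (- 2) k (- 2 - k) = of_int (k + 1)"
proof -
  consider "0 \<le> k" | "k = - 1" | "k \<le> - 2" by linarith
  then show ?thesis
  proof cases
    case 3
    then have "(of_nat (nat (- 2 - k)) :: complex) = - 2 - of_int k" by (simp add: of_nat_nat)
    then show ?thesis using 3 by (simp add: pow_diff_def gchoose_minus_2)
  qed (simp_all add: pow_diff_def gchoose_minus_2 of_nat_nat)
qed

section \<open>The formula for \<open>D\<close> and the translation property\<close>

lemmas gcoeff_eval = gcoeff_times_empty gcoeff_times_single gcoeff_times_pair gcoeff_gen gcoeff_one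
  gcoeff_diff plus_grassmann.rep_eq nu_def phi_mono_def less_ovar_def ovar_rank_def

lemma D_formula_homogeneous:
  assumes u: "u \<in> V p"
  shows "smul (gconst (1 / 2)) (Y (Y u {PhiM} 0 vac) {PhiP} 0 vac + Y (Y u {PhiP} 0 vac) {PhiM} 0 vac)
    = Y u {} 1 vac"
proof -
  have c: "pow_diff (- 2) (- 2) 0 - pow_diff (- 2) 0 (- 2) = 1"
    by (simp add: pow_diff_def)
  let ?E = "Y u {PhiP, PhiM} 0 vac"
  \<comment> \<open>In \<open>(\<phi>\<^sub>1\<^sup>+ -
    \<phi>\<^sub>2\<^sup>+)(\<phi>\<^sub>1\<^sup>- - \<phi>\<^sub>2\<^sup>-)\<close> the monomial
    \<open>\<phi>\<^sub>1\<^sup>+\<phi>\<^sub>2\<^sup>-\<close> has coefficient -1, but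
    \<open>\<phi>\<^sub>1\<^sup>-\<phi>\<^sub>2\<^sup>+\<close> has +1 after reordering. Hence
    \<open>?E\<close> enters the two equations with opposite signs.\<close>
  have 1: "Y u {} 1 vac = Y (Y u {PhiP} 0 vac) {PhiM} 0 vac - ?E"
    using iterate_vac[OF u, of "{Phi1P, Phi2M}" 0 0 vac]
    by (simp add: c Y_at_def at_vars_eq[OF inj_X(2)] sum_phi_set gcoeff_eval creation)
  have 2: "Y u {} 1 vac = Y (Y u {PhiM} 0 vac) {PhiP} 0 vac + ?E"
    using iterate_vac[OF u, of "{Phi1M, Phi2P}" 0 0 vac]
    by (simp add: c Y_at_def at_vars_eq[OF inj_X(2)] sum_phi_set gcoeff_eval creation)
  have "Y (Y u {PhiM} 0 vac) {PhiP} 0 vac + Y (Y u {PhiP} 0 vac) {PhiM} 0 vac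
      = Y u {} 1 vac + Y u {} 1 vac"
    using 1 2 by (simp add: algebra_simps)
  also have "smul (gconst (1 / 2)) \<dots> = smul (gconst (1 / 2 + 1 / 2)) (Y u {} 1 vac)"
    by (simp only: scalar.scale_right_distrib scalar.scale_left_distrib)
  finally show ?thesis by simp
qed

lemma translation_homogeneous:
  assumes u: "u \<in> V p"
  shows "Y (Y u {} 1 vac) S k w = smul (gconst (of_int (k + 1))) (Y u S (k + 1) w)"
proof -
  let ?Z = "Y u {} (k + 2) w"
  \<comment> \<open>The coefficient of the second-derivative term, kept symbolic because it cancels
    in the last case.\<close>
  define c where "c = 2 * (pow_diff (- 3) (- 3 - k) k + pow_diff (- 3) k (- 3 - k))"
  have iter: "smul (gconst (of_int (k + 1))) (Y_at smul Y X1 (gen Phi1P) (gen Phi1M) u (X1 (k + 1)) T w) +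
    smul (gconst (c * gcoeff nu T)) (Y u {} (k + 2) w) =
    (\<Sum>S'\<in>UNIV. \<Sum>S\<in>UNIV. smul (gconst (gcoeff
      (phi_mono (gen Phi1P - gen Phi2P) (gen Phi1M - gen Phi2M) S' *
       phi_mono (gen Phi2P) (gen Phi2M) S) T)) (Y (Y u S' 1 vac) S k w))"
    if "card T \<le> 2" for T
    using iterate_vac[OF u that, of 1 k w] pow_diff_minus_2_residue[of k]
    by (simp add: c_def add.commute)
  note eval = Y_at_def at_vars_eq[OF inj_X(2)] sum_phi_set gcoeff_eval
  show ?thesis
  proof (cases S rule: phi_set_cases)
    case 1
    then show ?thesis using iter[of "{}"] by (simp add: eval)
  next
    case 2
    \<comment> \<open>In degree one, setting \<open>\<phi>\<^sub>1 = \<phi>\<^sub>2\<close> means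
      adding the coefficients of \<open>\<phi>\<^sub>1\<^sup>+\<close> and
      \<open>\<phi>\<^sub>2\<^sup>+\<close>.\<close>
    have "smul (gconst (of_int (k + 1))) (Y u {PhiP} (k + 1) w) = Y (Y u {PhiP} 1 vac) {} k w"
      using iter[of "{Phi1P}"] by (simp add: eval)
    moreover have "0 = Y (Y u {} 1 vac) {PhiP} k w - Y (Y u {PhiP} 1 vac) {} k w"
      using iter[of "{Phi2P}"] by (simp add: eval)
    ultimately show ?thesis using 2 by simp
  next
    case 3
    have "smul (gconst (of_int (k + 1))) (Y u {PhiM} (k + 1) w) = Y (Y u {PhiM} 1 vac) {} k w"
      using iter[of "{Phi1M}"] by (simp add: eval)
    moreover have "0 = Y (Y u {} 1 vac) {PhiM} k w - Y (Y u {PhiM} 1 vac) {} k w"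
      using iter[of "{Phi2M}"] by (simp add: eval)
    ultimately show ?thesis using 3 by simp
  next
    case 4
    txt \<open>The substitution \<open>\<phi>\<^sub>1 = \<phi>\<^sub>2\<close> is a signed sum of four coefficients, in which the terms
      of the second derivative of \<open>Y u\<close> cancel.\<close>
    let ?A = "Y (Y u {PhiP, PhiM} 1 vac) {} k w"
    let ?B = "Y (Y u {PhiP} 1 vac) {PhiM} k w" and ?C = "Y (Y u {PhiM} 1 vac) {PhiP} k w"
    have "smul (gconst (of_int (k + 1))) (Y u {PhiP, PhiM} (k + 1) w) = ?A"
      using iter[of "{Phi1P, Phi1M}"] by (simp add: eval)
    moreover have "0 = ?A - ?B + ?C + Y (Y u {} 1 vac) {PhiP, PhiM} k w"
      using iter[of "{Phi2P, Phi2M}"] by (simp add: eval algebra_simps)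
    moreover have "smul (gconst c) ?Z = ?B - ?A"
      using iter[of "{Phi1P, Phi2M}"] by (simp add: eval algebra_simps)
    moreover have "smul (gconst c) ?Z = ?A + ?C"
      using iter[of "{Phi1M, Phi2P}"] by (simp add: eval algebra_simps)
    ultimately show ?thesis using 4 by (simp add: algebra_simps)
  qed
qed

text \<open>Both sides are additive in \<open>u\<close>, so the homogeneous case extends to all
  vectors.\<close>

lemma D_formula:
  "smul (gconst (1 / 2)) (Y (Y u {PhiM} 0 vac) {PhiP} 0 vac + Y (Y u {PhiP} 0 vac) {PhiM} 0 vac)
    = Y u {} 1 vac"
proof -
  obtain a b where ab: "a \<in> V 0" "b \<in> V 1" "u = a + b" using part_span by blast
  show ?thesis
    using D_formula_homogeneous[OF ab(1)] D_formula_homogeneous[OF ab(2)]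
    by (simp add: ab(3) Y_add scalar.scale_right_distrib algebra_simps)
qed

lemma translation:
  "Y (Y u {} 1 vac) S k w = smul (gconst (of_int (k + 1))) (Y u S (k + 1) w)"
proof -
  obtain a b where ab: "a \<in> V 0" "b \<in> V 1" "u = a + b" using part_span by blast
  show ?thesis
    by (simp only: ab(3) Y_add scalar.scale_right_distrib translation_homogeneous[OF ab(1)]
        translation_homogeneous[OF ab(2)])
qed

end

theorem corollary2p4:
  fixes L :: enat
    and smul :: "nat grassmann \<Rightarrow> 'v::ab_group_add \<Rightarrow> 'v"
    and V :: "bit \<Rightarrow> 'v set"
    and Y :: "'v \<Rightarrow> ('v \<Rightarrow> 'v) series"
    and vac :: 'v
    and Dp Dm D :: "'v \<Rightarrow> 'v"
  assumes "N2_vertex_superalgebra L smul V Y vac"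
    and "\<And>v. Dp v = mode_plus Y v (- 1) vac"
    and "\<And>v. Dm v = mode_minus Y v (- 1) vac"
    and "\<And>v. D v = smul (gconst (1 / 2)) (supercomm 1 1 Dp Dm v)"
  shows "(\<forall>v. Y (D v) = ddx smul (Y v)) \<and> (\<forall>v. D v = mode Y v (- 2) vac)"
proof -
  interpret N2_vertex_superalgebra L smul V Y vac by fact
  \<comment> \<open>Mode \<open>n\<close> belongs to the exponent \<open>- n - 1\<close>, so the
    modes defining \<open>Dp\<close> and \<open>Dm\<close> sit at exponent 0 and mode
    \<open>- 2\<close> at exponent 1. For two odd maps the supercommutator is a sum.\<close>
  have D: "D v = Y v {} 1 vac" for v
    using D_formula[of v] by (simp add: assms(2-4) supercomm_def psign_def mode_plus_def mode_minus_def)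
  moreover have "Y (Y v {} 1 vac) = ddx smul (Y v)" for v
    by (intro ext) (simp only: translation ddx_def gconst_of_int)
  ultimately show ?thesis by (simp add: mode_def)
qed

end
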